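(* Let $N\ge1$ and $\alpha\in\mathbb{Z}/N\mathbb{Z}$. For every $\boldsymbol{k}=(k_1,\ldots,k_r)\in\mathbb{Z}_{>0}^r$ and $\boldsymbol{\eta}=(\eta_1,\ldots,\eta_r)\in\mu_N^r$, the polynomial $L^{\mathcal{S}}_\alpha\left(\begin{smallmatrix}\boldsymbol{\eta}\\\boldsymbol{k}\end{smallmatrix};T\right)\in\mathbb{C}[T]$ defined in the context is constant, i.e. $L^{\mathcal{S}}_\alpha\binom{\boldsymbol{\eta}}{\boldsymbol{k}}\in\mathbb{C}$.
   Context: $\mu_N$ is the set of $N$-th roots of unity; for $\eta\in\mu_N$ and $\alpha\in\mathbb{Z}/N\mathbb{Z}$, $\eta^\alpha$ is well defined, and $\overline{\eta}$ is the complex conjugate. For an index $\binom{\eta_1,\ldots,\eta_r}{k_1,\ldots,k_r}$ ($\eta_i\in\mu_N$, $k_i\ge1$) let $L_m\binom{\eta_1,\ldots,\eta_r}{k_1,\ldots,k_r}=\sum_{m>m_1>\cdots>m_r>0}\frac{\eta_1^{m_1}\cdots\eta_r^{m_r}}{m_1^{k_1}\cdots m_r^{k_r}}$, and let $L_\ast\left(\begin{smallmatrix}\eta_1,\ldots,\eta_r\\k_1,\ldots,k_r\end{smallmatrix};T\right)\in\mathbb{C}[T]$ be the (harmonic-regularized) polynomial, which exists and is unique, such that $L_m=L_\ast(\,\cdot\,;\log m+\gamma)+O(\log^{J}m/m)$ as $m\to\infty$ for some $J$, with $\gamma$ Euler's constant; for the empty index $L_\ast=1$. The symmetric colored multiple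 zeta value of level $N$ is \[L^{\mathcal{S}}_\alpha\left(\begin{array}{c}\boldsymbol{\eta}\\\boldsymbol{k}\end{array};T\right)=\sum_{j=0}^r(-1)^{k_1+\cdots+k_j}(\eta_1\cdots\eta_j)^\alpha L_\ast\left(\begin{array}{c}\overline{\eta}_j,\ldots,\overline{\eta}_1\\k_j,\ldots,k_1\end{array};T+\frac{\pi i}{2}\right)L_\ast\left(\begin{array}{c}\eta_{j+1},\ldots,\eta_r\\k_{j+1},\ldots,k_r\end{array};T-\frac{\pi i}{2}\right).\] *)

theory Defs
  imports "HOL-Analysis.Analysis" "HOL-Library.Landau_Symbols"
begin

text \<open>
  An index of depth \<open>r\<close> is a pair of lists \<open>\<eta>\<close>, \<open>k\<close> of common length \<open>r\<close>; list positions are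
  0-based, so \<open>\<eta> ! i\<close> is the entry usually written with subscript \<open>i + 1\<close>.
\<close>

definition strict_chains :: "nat \<Rightarrow> nat \<Rightarrow> nat list set" where
  "strict_chains r m = {ms. length ms = r \<and> sorted_wrt (>) ms \<and> set ms \<subseteq> {0<..<m}}"

lemma finite_strict_chains: "finite (strict_chains r m)"
proof (rule finite_subset)
  show "strict_chains r m \<subseteq> {ms. set ms \<subseteq> {0<..<m} \<and> length ms = r}"
    by (auto simp: strict_chains_def)
qed (simp add: finite_lists_length_eq)

definition L_trunc :: "complex list \<Rightarrow> nat list \<Rightarrow> nat \<Rightarrow> complex" where
  "L_trunc \<eta> k m =
     (\<Sum>ms\<in>strict_chains (length k) m. \<Prod>i<length k. (\<eta> ! i) ^ (ms ! i) / of_nat (ms ! i) ^ (k ! i))"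

definition harmonic_regularization :: "complex list \<Rightarrow> nat list \<Rightarrow> complex poly \<Rightarrow> bool" where
  "harmonic_regularization \<eta> k P \<longleftrightarrow>
     (\<exists>J::nat. (\<lambda>m::nat. L_trunc \<eta> k m - poly P (of_real (ln (real m)) + euler_mascheroni))
        \<in> O(\<lambda>m. of_real (ln (real m) ^ J / real m)))"

text \<open>
  The uniqueness behind the definite description is \<open>harmonic_regularization_unique\<close> below. Existence
  (for \<open>\<eta>\<close> consisting of roots of unity and positive \<open>k\<close>) is not assumed anywhere, so a proof about
  \<open>L_star\<close> has to supply it. The value \<open>1\<close> at the empty index is \<open>L_star_Nil\<close>.
\<close>

definition L_star :: "complex list \<Rightarrow> nat list \<Rightarrow> complex poly" where
  "L_star \<eta> k = (THE P. harmonic_regularization \<eta> k P)"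

text \<open>
  The residue class \<open>\<alpha>\<close> modulo \<open>N\<close> is given by an arbitrary integer representative; by
  \<open>powi_cong_root_of_unity\<close> below, the choice is immaterial for \<open>N\<close>-th roots of unity. Composition with
  \<open>[:c, 1:]\<close> substitutes \<open>T + c\<close> for \<open>T\<close>.
\<close>

definition L_sym :: "int \<Rightarrow> complex list \<Rightarrow> nat list \<Rightarrow> complex poly" where
  "L_sym \<alpha> \<eta> k =
     (\<Sum>j\<le>length k.
        smult ((-1) ^ sum_list (take j k) * prod_list (take j \<eta>) powi \<alpha>)
          (pcompose (L_star (map cnj (rev (take j \<eta>))) (rev (take j k))) [:of_real pi * \<i> / 2, 1:]
           * pcompose (L_star (drop j \<eta>) (drop j k)) [:- (of_real pi * \<i> / 2), 1:]))"

lemma powi_cong_root_of_unity: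
  fixes z :: complex and a b :: int
  assumes "N \<ge> 1" "z ^ N = 1" "a mod int N = b mod int N"
  shows "z powi a = z powi b"
proof -
  have z0: "z \<noteq> 0"
    using assms by (auto simp: power_0_left)
  have *: "z powi c = z powi (c mod int N)" for c
  proof -
    have "z powi c = z powi (int N * (c div int N) + c mod int N)"
      by simp
    also have "\<dots> = (z powi int N) powi (c div int N) * z powi (c mod int N)"
      using z0 by (subst power_int_add) (auto simp: power_int_mult)
    also have "z powi int N = 1"
      using assms by simp
    finally show ?thesis
      by simp
  qed
  show ?thesis
    using *[of a] *[of b] assms(3) by simp
qed

lemma harmonic_regularization_unique:
  assumes "harmonic_regularization \<eta> k P" "harmonic_regularization \<eta> k Q"
  shows "P = Q"
proof (rule ccontr)
  assume "P \<noteq> Q"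
  define D where "D = P - Q"
  define z where "z = (\<lambda>m::nat. complex_of_real (ln (real m)) + euler_mascheroni)"
  have D0: "D \<noteq> 0"
    using \<open>P \<noteq> Q\<close> by (simp add: D_def)
  have lim0: "(\<lambda>m. L_trunc \<eta> k m - poly R (z m)) \<longlonglongrightarrow> 0"
    if R: "harmonic_regularization \<eta> k R" for R
  proof -
    obtain J :: nat where J: "(\<lambda>m. L_trunc \<eta> k m - poly R (z m))
        \<in> O(\<lambda>m. of_real (ln (real m) ^ J / real m))"
      using R unfolding harmonic_regularization_def z_def by blast
    have "(\<lambda>m::nat. ln (real m) ^ J / real m) \<longlonglongrightarrow> 0"
    proof (rule Lim_transform_eventually)
      show "(\<lambda>m. ln (real m) ^ J / exp (ln (real m))) \<longlonglongrightarrow> 0"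
        by (rule filterlim_compose[OF tendsto_power_div_exp_0
              filterlim_compose[OF ln_at_top filterlim_real_sequentially]])
      show "\<forall>\<^sub>F m in sequentially. ln (real m) ^ J / exp (ln (real m)) = ln (real m) ^ J / real m"
        using eventually_gt_at_top[of 0] by eventually_elim simp
    qed
    then have "(\<lambda>m::nat. complex_of_real (ln (real m) ^ J / real m)) \<longlonglongrightarrow> of_real 0"
      by (rule tendsto_of_real)
    then have "(\<lambda>m::nat. complex_of_real (ln (real m) ^ J / real m)) \<in> o(\<lambda>_. 1)"
      by (intro smalloI_tendsto) auto
    with J have "(\<lambda>m. L_trunc \<eta> k m - poly R (z m)) \<in> o(\<lambda>_. 1)"
      by (rule landau_o.big_small_trans)
    then show ?thesis
      by (auto dest: smalloD_tendsto)
  qed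
  have lim: "(\<lambda>m. poly D (z m)) \<longlonglongrightarrow> 0"
    using tendsto_diff[OF lim0[OF assms(2)] lim0[OF assms(1)]] by (simp add: D_def)
  have lnz: "filterlim (\<lambda>m. complex_of_real (ln (real m))) at_infinity sequentially"
    by (intro filterlim_compose[OF filterlim_of_real_at_infinity]
        filterlim_compose[OF ln_at_top] filterlim_real_sequentially)
  have zinf: "filterlim z at_infinity sequentially"
    unfolding z_def by (rule tendsto_add_filterlim_at_infinity'[OF lnz tendsto_const])
  show False
  proof (cases "degree D = 0")
    case True
    then obtain c where "D = [:c:]"
      by (rule degree_eq_zeroE)
    with lim D0 show False
      by (simp add: LIMSEQ_const_iff)
  next
    case False
    then have "filterlim (\<lambda>m. poly D (z m)) at_infinity sequentially"
      by (intro filterlim_compose[OF filterlim_poly_at_infinity zinf]) auto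
    with lim show False
      using not_tendsto_and_filterlim_at_infinity sequentially_bot by blast
  qed
qed

lemma L_star_Nil: "L_star [] [] = 1"
proof -
  have "strict_chains 0 m = {[]}" for m
    by (auto simp: strict_chains_def)
  then have "harmonic_regularization [] [] 1"
    by (simp add: harmonic_regularization_def L_trunc_def)
  then show ?thesis
    unfolding L_star_def by (blast intro: the_equality harmonic_regularization_unique)
qed

end

theory Submission
  imports Defs "HOL-Real_Asymp.Real_Asymp"
begin

text \<open>
  The truncated sums satisfy \<open>L\<^sub>m\<^sub>+\<^sub>1 - L\<^sub>m = \<eta>\<^sub>1\<^sup>m / m\<^sup>k L'\<^sub>m\<close>, where \<open>k\<close> is the first exponent and \<open>L'\<close>
  belongs to the index with its first column removed. If \<open>L'\<^sub>m\<close> is asymptotically a polynomial \<open>P\<close> in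
  \<open>log m + \<gamma>\<close>, summing up shows that \<open>L\<^sub>m\<close> is asymptotically an antiderivative of \<open>P\<close> if the first
  column is \<open>(1; 1)\<close>, and a constant otherwise (absolute convergence for \<open>k \<ge> 2\<close>, summation by parts
  for \<open>k = 1\<close> and \<open>\<eta>\<^sub>1 \<noteq> 1\<close>). Thus \<open>d/dT\<close> acts on the regularized polynomials by deleting a leading
  column \<open>(1; 1)\<close> and killing every other index. In the derivative of the symmetric value, deleting
  column \<open>j + 1\<close> from the right factor of term \<open>j\<close> cancels against deleting it from the left factor of
  term \<open>j + 1\<close>, because \<open>k\<^sub>j\<^sub>+\<^sub>1 = 1\<close> flips the sign while \<open>\<eta>\<^sub>j\<^sub>+\<^sub>1 = 1\<close> leaves the root of unity unchanged.
\<close>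

section \<open>Error classes: powers of the logarithm over powers of n\<close>

text \<open>
  Leaving the power of the logarithm existentially quantified makes these classes closed under
  addition and multiplicatively graded, so the power need not be tracked.
\<close>

definition logO :: "nat \<Rightarrow> (nat \<Rightarrow> complex) set" where
  "logO d = (\<Union>J. O(\<lambda>n. of_real (ln (real n) ^ J / real n ^ d)))"

lemma logO_I: "f \<in> O(\<lambda>n. of_real (ln (real n) ^ J / real n ^ d)) \<Longrightarrow> f \<in> logO d"
  by (auto simp: logO_def)

lemma logO_E:
  assumes "f \<in> logO d"
  obtains J where "f \<in> O(\<lambda>n. of_real (ln (real n) ^ J / real n ^ d))"
  using assms by (auto simp: logO_def)

lemma eventually_ln_ge_1: "eventually (\<lambda>n::nat. ln (real n) \<ge> 1) sequentially"
  by real_asymp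

text \<open>Once \<open>ln n \<ge> 1\<close>, a higher power of the logarithm or a lower power of
  \<open>n\<close> in the denominator only enlarges the scale.\<close>

lemma logO_scale_mono:
  assumes "J \<le> K" "e \<le> d"
  shows "(\<lambda>n. complex_of_real (ln (real n) ^ J / real n ^ d))
           \<in> O(\<lambda>n. of_real (ln (real n) ^ K / real n ^ e))"
proof (rule landau_o.big_mono)
  show "\<forall>\<^sub>F n in sequentially. norm (complex_of_real (ln (real n) ^ J / real n ^ d))
          \<le> norm (complex_of_real (ln (real n) ^ K / real n ^ e))"
    using eventually_ln_ge_1 eventually_gt_at_top[of 0]
  proof eventually_elim
    case (elim n)
    have "ln (real n) ^ J / real n ^ d \<le> ln (real n) ^ K / real n ^ e"
      using elim assms by (intro frac_le power_increasing) auto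
    moreover have "0 \<le> ln (real n) ^ J / real n ^ d"
      using elim by simp
    ultimately show ?case
      by (simp only: norm_of_real)
  qed
qed

lemma logO_mono: "f \<in> logO d \<Longrightarrow> e \<le> d \<Longrightarrow> f \<in> logO e"
  by (elim logO_E, rule logO_I, erule landau_o.big_trans) (rule logO_scale_mono[OF order_refl])

lemma logO_add:
  assumes "f \<in> logO d" "g \<in> logO d"
  shows "(\<lambda>n. f n + g n) \<in> logO d"
proof -
  obtain J K where "f \<in> O(\<lambda>n. of_real (ln (real n) ^ J / real n ^ d))"
    "g \<in> O(\<lambda>n. of_real (ln (real n) ^ K / real n ^ d))"
    using assms by (elim logO_E)
  then have "f \<in> O(\<lambda>n. of_real (ln (real n) ^ max J K / real n ^ d))"
    "g \<in> O(\<lambda>n. of_real (ln (real n) ^ max J K / real n ^ d))"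
    by (blast intro: landau_o.big_trans logO_scale_mono max.cobounded1 max.cobounded2 order_refl)+
  then show ?thesis
    by (intro logO_I sum_in_bigo)
qed

lemma logO_mult:
  assumes "f \<in> logO d" "g \<in> logO e" "c = d + e"
  shows "(\<lambda>n. f n * g n) \<in> logO c"
proof -
  obtain J K where "f \<in> O(\<lambda>n. of_real (ln (real n) ^ J / real n ^ d))"
    "g \<in> O(\<lambda>n. of_real (ln (real n) ^ K / real n ^ e))"
    using assms(1,2) by (elim logO_E)
  from landau_o.big.mult[OF this] show ?thesis
    by (intro logO_I[of _ "J + K"]) (simp add: power_add assms(3))
qed

lemma logO_bigo_1: "f \<in> O(\<lambda>_. 1) \<Longrightarrow> f \<in> logO 0"
  by (rule logO_I[of _ 0]) simp

lemma logO_const: "(\<lambda>_. c) \<in> logO 0"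
  by (intro logO_bigo_1) simp

lemma logO_inverse: "(\<lambda>n. 1 / of_nat n) \<in> logO 1"
  by (rule logO_I[of _ 0]) simp

lemma logO_cmult: "f \<in> logO d \<Longrightarrow> (\<lambda>n. c * f n) \<in> logO d"
  by (rule logO_mult[OF logO_const]) auto

lemma logO_uminus: "f \<in> logO d \<Longrightarrow> (\<lambda>n. - f n) \<in> logO d"
  using logO_cmult[of f d "-1"] by simp

lemma logO_diff: "f \<in> logO d \<Longrightarrow> g \<in> logO d \<Longrightarrow> (\<lambda>n. f n - g n) \<in> logO d"
  using logO_add[of f d "\<lambda>n. - g n"] logO_uminus[of g d] by simp

text \<open>Asymptotics ignore \<open>n = 0\<close>, so identities between \<open>f\<close> and
  \<open>g\<close> may clear the denominator \<open>of_nat n\<close>.\<close>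

lemma logO_cong:
  assumes "f \<in> logO d" "\<And>n. n > 0 \<Longrightarrow> f n = g n"
  shows "g \<in> logO d"
proof -
  have "eventually (\<lambda>n. f n = g n) sequentially"
    using eventually_gt_at_top[of 0] by eventually_elim (rule assms(2))
  with assms(1) show ?thesis
    by (elim logO_E, intro logO_I) (simp cong: landau_o.big.in_cong)
qed

section \<open>Polynomials in log n + \<gamma> under the shift n to n + 1\<close>

definition log_gamma :: "nat \<Rightarrow> complex" where
  "log_gamma n = of_real (ln (real n)) + euler_mascheroni"

lemma log_gamma_logO: "log_gamma \<in> logO 0"
proof -
  have "(\<lambda>n. of_real (ln (real n))) \<in> logO 0"
    by (rule logO_I[of _ 1]) simp
  then show ?thesis
    unfolding log_gamma_def by (intro logO_add logO_const)
qed

lemma log_gamma_Suc: "(\<lambda>n. log_gamma (Suc n) - log_gamma n - 1 / of_nat n) \<in> logO 2"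
proof -
  have "(\<lambda>n. ln (real (Suc n)) - ln (real n) - 1 / real n) \<in> O(\<lambda>n. 1 / real n ^ 2)"
    by real_asymp
  then have "(\<lambda>n. complex_of_real (ln (real (Suc n)) - ln (real n) - 1 / real n))
      \<in> O(\<lambda>n. of_real (1 / real n ^ 2))"
    by (simp only: landau_o.big.of_real_iff)
  then show ?thesis
    by (intro logO_I[of _ 0]) (simp add: log_gamma_def)
qed

lemma poly_log_gamma_logO: "(\<lambda>n. poly p (log_gamma n)) \<in> logO 0"
proof (induction p)
  case (pCons a p)
  then show ?case
    using logO_add[OF logO_const[of a] logO_mult[OF log_gamma_logO pCons.IH add_0[symmetric]]] by simp
qed (simp add: logO_const)

text \<open>First-order Taylor expansion with step about \<open>1 / n\<close>, proved along the
  Horner scheme by a discrete product rule.\<close>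

lemma poly_log_gamma_Suc:
  "(\<lambda>n. poly p (log_gamma (Suc n)) - poly p (log_gamma n) - poly (pderiv p) (log_gamma n) / of_nat n)
     \<in> logO 2"
proof (induction p)
  case 0
  show ?case
    using logO_cmult[OF log_gamma_Suc, of 0] by simp
next
  case (pCons a p)
  let ?z = log_gamma and ?i = "\<lambda>n. 1 / of_nat n :: complex"
  let ?d = "\<lambda>n. poly p (?z (Suc n)) - poly p (?z n) - poly (pderiv p) (?z n) / of_nat n"
  let ?e = "\<lambda>n. ?z (Suc n) - ?z n - ?i n"
  \<comment> \<open>The function is \<open>poly p (?z (Suc n)) - poly p (?z n)\<close>, written
    through the error \<open>?d\<close> of the induction hypothesis.\<close>
  have diff: "(\<lambda>n. ?d n + ?i n * poly (pderiv p) (?z n)) \<in> logO 1"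
    by (intro logO_add logO_mono[OF pCons.IH] logO_mult[OF logO_inverse poly_log_gamma_logO]) auto
  then have Suc: "(\<lambda>n. ?d n + ?i n * poly (pderiv p) (?z n) + poly p (?z n)) \<in> logO 0"
    by (intro logO_add[OF logO_mono poly_log_gamma_logO]) auto
  have "(\<lambda>n. ?z n * ?d n
           + ?e n * (?d n + ?i n * poly (pderiv p) (?z n) + poly p (?z n))
           + ?i n * (?d n + ?i n * poly (pderiv p) (?z n))) \<in> logO 2"
    by (intro logO_add logO_mult[OF log_gamma_logO pCons.IH] logO_mult[OF log_gamma_Suc Suc]
        logO_mult[OF logO_inverse diff]) auto
  then show ?case
    by (rule logO_cong) (simp add: pderiv_pCons algebra_simps add_divide_distrib)
qed

text \<open>The numerator and the factor \<open>1 / n\<close> both vary slowly, so differencing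
  gains one power of \<open>n\<close>. This feeds the summation by parts.\<close>

lemma poly_log_gamma_div_Suc:
  "(\<lambda>n. poly p (log_gamma (Suc n)) / of_nat (Suc n) - poly p (log_gamma n) / of_nat n) \<in> logO 2"
proof -
  let ?d = "\<lambda>n. poly p (log_gamma (Suc n)) - poly p (log_gamma n)
               - poly (pderiv p) (log_gamma n) / of_nat n"
  have inv_Suc: "(\<lambda>n. 1 / of_nat (Suc n)) \<in> logO 1"
  proof -
    have "(\<lambda>n. 1 / real (Suc n)) \<in> O(\<lambda>n. 1 / real n)"
      by real_asymp
    then have "(\<lambda>n. complex_of_real (1 / real (Suc n))) \<in> O(\<lambda>n. of_real (1 / real n))"
      by (simp only: landau_o.big.of_real_iff)
    then show ?thesis
      by (intro logO_I[of _ 0]) simp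
  qed
  have diff: "(\<lambda>n. ?d n + 1 / of_nat n * poly (pderiv p) (log_gamma n)) \<in> logO 1"
    by (intro logO_add logO_mono[OF poly_log_gamma_Suc] logO_mult[OF logO_inverse poly_log_gamma_logO])
       auto
  have "(\<lambda>n. 1 / of_nat n * poly p (log_gamma n)) \<in> logO 1"
    by (intro logO_mult[OF logO_inverse poly_log_gamma_logO]) auto
  \<comment> \<open>Uses \<open>x' / (n + 1) - x / n = (x' - x) / (n + 1) - x / (n * (n +
    1))\<close>.\<close>
  then have "(\<lambda>n. 1 / of_nat (Suc n) * (?d n + 1 / of_nat n * poly (pderiv p) (log_gamma n))
      - 1 / of_nat (Suc n) * (1 / of_nat n * poly p (log_gamma n))) \<in> logO 2"
    by (intro logO_diff logO_mult[OF inv_Suc diff] logO_mult[OF inv_Suc]) auto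
  then show ?thesis
    by (rule logO_cong) (simp add: divide_simps del: of_nat_Suc, simp add: algebra_simps)
qed

section \<open>From increments to sums\<close>

text \<open>The derivative of \<open>ln x ^ J / x\<close> is asymptotic to
  \<open>- (ln x ^ J / x ^ 2)\<close>. Any constant above 1 would serve in place of 8.\<close>

lemma ln_power_div_telescope:
  "eventually (\<lambda>n. ln (real n) ^ J / real n ^ 2
     \<le> 8 * (ln (real n) ^ J / real n - ln (real (Suc n)) ^ J / real (Suc n))) sequentially"
  by real_asymp

lemma logO_sum_tail:
  assumes "a \<in> logO 2"
  obtains c where "(\<lambda>m. (\<Sum>n<m. a n) - c) \<in> logO 1"
proof -
  obtain J where "a \<in> O(\<lambda>n. of_real (ln (real n) ^ J / real n ^ 2))"
    using assms by (elim logO_E)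
  then obtain C where C: "C > 0"
    "eventually (\<lambda>n. norm (a n) \<le> C * norm (complex_of_real (ln (real n) ^ J / real n ^ 2))) sequentially"
    by (elim landau_o.bigE)
  \<comment> \<open>A majorant whose decrements dominate \<open>norm (a n)\<close>; it bounds the
    tails of the series by telescoping.\<close>
  define u where "u = (\<lambda>n. 8 * C * (ln (real n) ^ J / real n))"
  have u_nonneg: "u n \<ge> 0" for n
    using C(1) by (cases n) (auto simp: u_def)
  have "(\<lambda>n. ln (real n) ^ J / real n) \<longlonglongrightarrow> 0"
    by real_asymp
  then have u_lim: "u \<longlonglongrightarrow> 0"
    unfolding u_def by (rule tendsto_mult_right_zero)
  have "eventually (\<lambda>n. norm (a n) \<le> u n - u (Suc n)) sequentially"
    using C(2) ln_power_div_telescope[of J] eventually_ln_ge_1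
  proof eventually_elim
    case (elim n)
    have "norm (a n) \<le> C * (ln (real n) ^ J / real n ^ 2)"
      using elim by (simp add: norm_divide norm_power)
    also have "\<dots> \<le> C * (8 * (ln (real n) ^ J / real n - ln (real (Suc n)) ^ J / real (Suc n)))"
      using elim C(1) by (intro mult_left_mono) auto
    also have "\<dots> = u n - u (Suc n)"
      by (simp add: u_def algebra_simps)
    finally show ?case .
  qed
  then obtain N where N: "\<And>n. n \<ge> N \<Longrightarrow> norm (a n) \<le> u n - u (Suc n)"
    by (auto simp: eventually_sequentially)
  have "summable a"
    using telescope_summable'[OF u_lim] N by (rule summable_comparison_test')
  then have lim: "(\<lambda>l. \<Sum>n<l. a n) \<longlonglongrightarrow> suminf a"
    by (rule summable_LIMSEQ)
  have bound: "norm ((\<Sum>n<l. a n) - (\<Sum>n<m. a n)) \<le> u m - u l" if "N \<le> m" "m \<le> l" for l m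
    using that(2)
  proof (induction l rule: dec_induct)
    case (step l)
    have "norm ((\<Sum>n<Suc l. a n) - (\<Sum>n<m. a n)) \<le> norm ((\<Sum>n<l. a n) - (\<Sum>n<m. a n)) + norm (a l)"
      using norm_triangle_ineq[of "(\<Sum>n<l. a n) - (\<Sum>n<m. a n)" "a l"] by (simp add: algebra_simps)
    with step.IH N[of l] step.hyps that(1) show ?case
      by simp
  qed simp
  \<comment> \<open>Let \<open>l\<close> tend to infinity in \<open>bound\<close>, dropping the
    nonnegative \<open>u l\<close>.\<close>
  have "norm ((\<Sum>n<m. a n) - suminf a) \<le> u m" if "N \<le> m" for m
  proof -
    have "norm (suminf a - (\<Sum>n<m. a n)) \<le> u m"
    proof (rule tendsto_upperbound)
      show "(\<lambda>l. norm ((\<Sum>n<l. a n) - (\<Sum>n<m. a n))) \<longlonglongrightarrow> norm (suminf a - (\<Sum>n<m. a n))"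
        by (intro tendsto_intros lim)
      show "\<forall>\<^sub>F l in sequentially. norm ((\<Sum>n<l. a n) - (\<Sum>n<m. a n)) \<le> u m"
        using eventually_ge_at_top[of m]
      proof eventually_elim
        case (elim l)
        show ?case
          using bound[OF that elim] u_nonneg[of l] by linarith
      qed
    qed simp
    then show ?thesis
      by (simp add: norm_minus_commute)
  qed
  then have "(\<lambda>m. (\<Sum>n<m. a n) - suminf a) \<in> O(\<lambda>n. of_real (ln (real n) ^ J / real n ^ 1))"
  proof (intro landau_o.bigI[of "8 * C"] eventually_sequentiallyI[of N])
    fix m assume "\<And>m. N \<le> m \<Longrightarrow> norm ((\<Sum>n<m. a n) - suminf a) \<le> u m" "N \<le> m"
    then have "norm ((\<Sum>n<m. a n) - suminf a) \<le> u m"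
      by blast
    also have "u m \<le> 8 * C * norm (complex_of_real (ln (real m) ^ J / real m ^ 1))"
      unfolding u_def norm_of_real using C(1) by (intro mult_left_mono) (auto intro: divide_right_mono)
    finally show "norm ((\<Sum>n<m. a n) - suminf a)
        \<le> 8 * C * norm (complex_of_real (ln (real m) ^ J / real m ^ 1))" .
  qed (use C in auto)
  then show ?thesis
    by (intro that logO_I)
qed

text \<open>The difference of the increments is summable with tails in \<open>logO 1\<close>; the
  limit and the initial values make up \<open>c\<close>.\<close>

lemma logO_of_increments:
  assumes "(\<lambda>n. (f (Suc n) - f n) - (g (Suc n) - g n)) \<in> logO 2"
  obtains c where "(\<lambda>m. f m - (g m + c)) \<in> logO 1"
proof -
  obtain c where "(\<lambda>m. (\<Sum>n<m. (f (Suc n) - f n) - (g (Suc n) - g n)) - c) \<in> logO 1"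
    using logO_sum_tail[OF assms] .
  then have "(\<lambda>m. f m - (g m + (c + f 0 - g 0))) \<in> logO 1"
    by (rule logO_cong) (subst sum_subtractf, simp add: sum_lessThan_telescope)
  then show ?thesis
    by (rule that)
qed

section \<open>Recursion for the truncated sums and their asymptotics\<close>

lemma harmonic_regularization_iff:
  "harmonic_regularization \<eta> k P \<longleftrightarrow> (\<lambda>m. L_trunc \<eta> k m - poly P (log_gamma m)) \<in> logO 1"
  by (simp add: harmonic_regularization_def logO_def log_gamma_def)

text \<open>Chains are split by whether their largest entry, the head, equals
  \<open>m\<close>.\<close>

lemma strict_chains_Suc:
  assumes "m > 0"
  shows "strict_chains (Suc r) (Suc m) = strict_chains (Suc r) m \<union> (#) m ` strict_chains r m"
proof (intro equalityI subsetI)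
  fix ms assume "ms \<in> strict_chains (Suc r) (Suc m)"
  then obtain x xs where "ms = x # xs" "length xs = r" "sorted_wrt (>) xs" "\<forall>y\<in>set xs. y < x"
    "x \<le> m" "0 < x" "set xs \<subseteq> {0<..<Suc m}"
    by (cases ms) (auto simp: strict_chains_def)
  then show "ms \<in> strict_chains (Suc r) m \<union> (#) m ` strict_chains r m"
    by (cases "x = m") (fastforce simp: strict_chains_def)+
qed (use assms in \<open>fastforce simp: strict_chains_def\<close>)

lemma L_trunc_Cons_Suc:
  assumes "m > 0"
  shows "L_trunc (e # \<eta>) (a # k) (Suc m) - L_trunc (e # \<eta>) (a # k) m
           = e ^ m / of_nat m ^ a * L_trunc \<eta> k m"
proof -
  have disj: "strict_chains (Suc (length k)) m \<inter> (#) m ` strict_chains (length k) m = {}"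
    by (auto simp: strict_chains_def)
  show ?thesis
    unfolding L_trunc_def length_Cons strict_chains_Suc[OF assms]
    by (subst sum.union_disjoint)
       (use disj in \<open>auto simp: finite_strict_chains sum.reindex inj_on_def prod.lessThan_Suc_shift
          sum_distrib_left simp del: prod.lessThan_Suc\<close>)
qed

lemmas pderiv_sum = higher_pderiv_sum[of 1, simplified]

lemma ex_pderiv_eq:
  fixes p :: "'a :: field_char_0 poly"
  shows "\<exists>q. pderiv q = p"
proof
  show "pderiv (\<Sum>i\<le>degree p. monom (coeff p i / of_nat (Suc i)) (Suc i)) = p"
    by (simp add: pderiv_sum pderiv_monom poly_as_sum_of_monoms del: of_nat_Suc)
qed

text \<open>Existence and derivative come from the same comparison of increments. The bound on
  \<open>norm e\<close> keeps \<open>e ^ n\<close> in \<open>logO 0\<close>.\<close>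

lemma harmonic_regularization_Cons:
  assumes "norm e \<le> 1" "a > 0" "harmonic_regularization \<eta> k P"
  shows "\<exists>Q. harmonic_regularization (e # \<eta>) (a # k) Q \<and> pderiv Q = (if e = 1 \<and> a = 1 then P else 0)"
proof -
  let ?z = log_gamma and ?L = "L_trunc \<eta> k" and ?M = "L_trunc (e # \<eta>) (a # k)"
  have err: "(\<lambda>n. ?L n - poly P (?z n)) \<in> logO 1"
    using assms(3) by (simp add: harmonic_regularization_iff)
  then have L: "?L \<in> logO 0"
    using logO_add[OF logO_mono[OF err] poly_log_gamma_logO[of P]] by simp
  have pow: "(\<lambda>n. e ^ n) \<in> logO 0"
    using assms(1) by (intro logO_bigo_1 landau_o.bigI[of 1]) (auto simp: norm_power power_le_one)
  have "a = 1 \<or> a \<ge> 2"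
    using assms(2) by linarith
  then consider "a \<ge> 2" | "a = 1" "e \<noteq> 1" | "a = 1" "e = 1"
    by blast
  then show ?thesis
  proof cases
    case 1
    have inv: "(\<lambda>n. 1 / of_nat n ^ a) \<in> logO 2"
      using 1 by (intro logO_mono[OF logO_I[of _ 0 a]]) auto
    have "(\<lambda>n. e ^ n * (1 / of_nat n ^ a * ?L n)) \<in> logO 2"
      by (intro logO_mult[OF pow logO_mult[OF inv L]]) auto
    then have "(\<lambda>n. (?M (Suc n) - ?M n) - ((\<lambda>_. 0) (Suc n) - (\<lambda>_. 0) n)) \<in> logO 2"
      by (rule logO_cong) (simp add: L_trunc_Cons_Suc)
    then obtain c where "(\<lambda>m. ?M m - (0 + c)) \<in> logO 1"
      by (rule logO_of_increments)
    then show ?thesis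
      using 1 by (intro exI[of _ "[:c:]"]) (auto simp: harmonic_regularization_iff pderiv_pCons)
  next
    case 2
    txt \<open>Summation by parts: \<open>e\<^sup>n\<close> is the increment of \<open>e\<^sup>n / (e - 1)\<close>.\<close>
    let ?h = "\<lambda>n. poly P (?z n) / of_nat n" and ?g = "\<lambda>n. e ^ n / (e - 1) * (poly P (?z n) / of_nat n)"
    \<comment> \<open>The increment of \<open>?g\<close> is \<open>e ^ n * ?h n\<close> plus
      \<open>e / (e - 1) * e ^ n * (?h (Suc n) - ?h n)\<close>.\<close>
    have "(\<lambda>n. e ^ n * (1 / of_nat n * (?L n - poly P (?z n)))
               - e / (e - 1) * (e ^ n * (?h (Suc n) - ?h n))) \<in> logO 2"
      by (intro logO_diff logO_cmult logO_mult[OF pow poly_log_gamma_div_Suc]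
          logO_mult[OF pow logO_mult[OF logO_inverse err]]) auto
    then have "(\<lambda>n. (?M (Suc n) - ?M n) - (?g (Suc n) - ?g n)) \<in> logO 2"
      by (rule logO_cong)
         (use 2 in \<open>simp add: L_trunc_Cons_Suc divide_simps del: of_nat_Suc, simp add: algebra_simps\<close>)
    then obtain c where "(\<lambda>m. ?M m - (?g m + c)) \<in> logO 1"
      by (rule logO_of_increments)
    \<comment> \<open>This is \<open>?g\<close> itself; being in \<open>logO 1\<close>, it
      disappears into the error and leaves only the constant.\<close>
    moreover have "(\<lambda>n. 1 / (e - 1) * (e ^ n * (1 / of_nat n * poly P (?z n)))) \<in> logO 1"
      by (intro logO_cmult logO_mult[OF pow logO_mult[OF logO_inverse poly_log_gamma_logO]]) auto
    ultimately have "(\<lambda>m. ?M m - (?g m + c) + 1 / (e - 1) * (e ^ m * (1 / of_nat m * poly P (?z m)))) \<in> logO 1"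
      by (rule logO_add)
    then have "(\<lambda>m. ?M m - c) \<in> logO 1"
      by (rule logO_cong) simp
    then show ?thesis
      using 2 by (intro exI[of _ "[:c:]"]) (auto simp: harmonic_regularization_iff pderiv_pCons)
  next
    case 3
    obtain Q where Q: "pderiv Q = P"
      using ex_pderiv_eq by blast
    \<comment> \<open>Both \<open>?L n / n\<close> and the increment of \<open>poly Q\<close> at
      \<open>?z n\<close> agree with \<open>poly P (?z n) / n\<close> up to
      \<open>logO 2\<close>.\<close>
    have "(\<lambda>n. 1 / of_nat n * (?L n - poly P (?z n))
             - (poly Q (?z (Suc n)) - poly Q (?z n) - poly (pderiv Q) (?z n) / of_nat n)) \<in> logO 2"
      by (intro logO_diff poly_log_gamma_Suc logO_mult[OF logO_inverse err]) auto
    then have "(\<lambda>n. (?M (Suc n) - ?M n) - (poly Q (?z (Suc n)) - poly Q (?z n))) \<in> logO 2"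
      by (rule logO_cong) (use 3 in \<open>simp add: L_trunc_Cons_Suc Q diff_divide_distrib\<close>)
    then obtain c where "(\<lambda>m. ?M m - (poly Q (?z m) + c)) \<in> logO 1"
      by (rule logO_of_increments)
    then show ?thesis
      using 3 Q by (intro exI[of _ "Q + [:c:]"]) (auto simp: harmonic_regularization_iff pderiv_add pderiv_pCons)
  qed
qed

section \<open>Existence and derivative of the regularized polynomials\<close>

lemma L_star_eqI: "harmonic_regularization \<eta> k P \<Longrightarrow> L_star \<eta> k = P"
  unfolding L_star_def by (blast intro: the_equality harmonic_regularization_unique)

text \<open>Columns are prepended one at a time; together with uniqueness this shows that the
  definite description in \<open>L_star\<close> denotes.\<close>

lemma harmonic_regularization_L_star:
  assumes "length \<eta> = length k" "\<forall>z\<in>set \<eta>. norm z \<le> 1" "\<forall>n\<in>set k. n > 0"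
  shows "harmonic_regularization \<eta> k (L_star \<eta> k)"
  using assms
proof (induction \<eta> k rule: list_induct2)
  case Nil
  have "L_trunc [] [] m = 1" for m
    by (auto simp: L_trunc_def strict_chains_def card_1_singleton_iff intro!: exI[of _ "[]"])
  then show ?case
    by (simp add: harmonic_regularization_def L_star_Nil)
next
  case (Cons e \<eta> a k)
  then obtain Q where "harmonic_regularization (e # \<eta>) (a # k) Q"
    using harmonic_regularization_Cons[of e a \<eta> k "L_star \<eta> k"] by auto
  then show ?case
    using L_star_eqI by blast
qed

text \<open>By uniqueness the polynomial produced by \<open>harmonic_regularization_Cons\<close> is
  \<open>L_star\<close> itself.\<close>

lemma pderiv_L_star_Cons:
  assumes "length \<eta> = length k" "\<forall>z\<in>set (e # \<eta>). norm z \<le> 1" "\<forall>n\<in>set (a # k). n > 0"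
  shows "pderiv (L_star (e # \<eta>) (a # k)) = (if e = 1 \<and> a = 1 then L_star \<eta> k else 0)"
proof -
  have "harmonic_regularization \<eta> k (L_star \<eta> k)"
    using assms by (intro harmonic_regularization_L_star) auto
  then obtain Q where "harmonic_regularization (e # \<eta>) (a # k) Q"
    "pderiv Q = (if e = 1 \<and> a = 1 then L_star \<eta> k else 0)"
    using harmonic_regularization_Cons[of e a \<eta> k] assms(2,3) by force
  then show ?thesis
    using L_star_eqI by metis
qed

section \<open>Cancellation in the derivative of the symmetric value\<close>

theorem theorem3p6:
  fixes N :: nat and \<alpha> :: int and \<eta> :: "complex list" and k :: "nat list"
  assumes "N \<ge> 1"
    and "length \<eta> = length k"
    and "\<forall>z\<in>set \<eta>. z ^ N = 1"
    and "\<forall>n\<in>set k. n > 0"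
  shows "\<exists>c. L_sym \<alpha> \<eta> k = [:c:]"
proof -
  have norm: "norm z \<le> 1" if "z \<in> set \<eta>" for z
    using power_eq_1_iff[of z N] assms(1,3) that by force
  define s where "s j = (-1) ^ sum_list (take j k) * prod_list (take j \<eta>) powi \<alpha>" for j
  define p where "p = [:of_real pi * \<i> / 2, 1 :: complex:]"
  define q where "q = [:- (of_real pi * \<i> / 2), 1 :: complex:]"
  define A where "A j = L_star (map cnj (rev (take j \<eta>))) (rev (take j k))" for j
  define B where "B j = L_star (drop j \<eta>) (drop j k)" for j
  define \<delta> where "\<delta> j \<longleftrightarrow> \<eta> ! j = 1 \<and> k ! j = 1" for j
  have A_0: "pderiv (A 0) = 0" and B_length: "pderiv (B (length k)) = 0"
    using assms(2) by (simp_all add: A_def B_def L_star_Nil)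
  \<comment> \<open>Reversal puts column \<open>j\<close> at the head of the left factor, and
    conjugation fixes 1, so \<open>\<delta> j\<close> governs both factors.\<close>
  have A_Suc: "pderiv (A (Suc j)) = (if \<delta> j then A j else 0)" if "j < length k" for j
  proof -
    have "set (take j \<eta>) \<subseteq> set \<eta>" "set (take j k) \<subseteq> set k"
      by (rule set_take_subset)+
    then have "pderiv (L_star (cnj (\<eta> ! j) # map cnj (rev (take j \<eta>))) (k ! j # rev (take j k)))
        = (if cnj (\<eta> ! j) = 1 \<and> k ! j = 1 then A j else 0)"
      unfolding A_def using that assms(2,4) norm by (intro pderiv_L_star_Cons) auto
    then show ?thesis
      using that assms(2) by (simp add: A_def \<delta>_def take_Suc_conv_app_nth)
  qed
  have B_Suc: "pderiv (B j) = (if \<delta> j then B (Suc j) else 0)" if "j < length k" for j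
  proof -
    have "set (drop (Suc j) \<eta>) \<subseteq> set \<eta>" "set (drop (Suc j) k) \<subseteq> set k"
      by (rule set_drop_subset)+
    then have "pderiv (L_star (\<eta> ! j # drop (Suc j) \<eta>) (k ! j # drop (Suc j) k))
        = (if \<eta> ! j = 1 \<and> k ! j = 1 then B (Suc j) else 0)"
      unfolding B_def using that assms(2,4) norm by (intro pderiv_L_star_Cons) auto
    then show ?thesis
      using that assms(2) by (simp add: B_def \<delta>_def Cons_nth_drop_Suc)
  qed
  have s_Suc: "s (Suc j) = - s j" if "j < length k" "\<delta> j" for j
    using that assms(2) by (simp add: s_def \<delta>_def take_Suc_conv_app_nth)
  \<comment> \<open>The substitutions are translations, so the chain rule adds no factor.\<close>
  have pq: "pderiv p = 1" "pderiv q = 1"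
    by (simp_all add: p_def q_def pderiv_pCons)
  let ?F = "\<lambda>j. smult (s j) (pcompose (pderiv (A j)) p * pcompose (B j) q)"
  let ?G = "\<lambda>j. smult (s j) (pcompose (A j) p * pcompose (pderiv (B j)) q)"
  have cancel: "?F (Suc j) + ?G j = 0" if "j < length k" for j
    using s_Suc[OF that] by (simp add: A_Suc[OF that] B_Suc[OF that])
  have "L_sym \<alpha> \<eta> k = (\<Sum>j\<le>length k. smult (s j) (pcompose (A j) p * pcompose (B j) q))"
    by (simp only: L_sym_def s_def p_def q_def A_def B_def)
  then have "pderiv (L_sym \<alpha> \<eta> k) = (\<Sum>j\<le>length k. ?F j + ?G j)"
    by (simp add: pderiv_sum pderiv_smult pderiv_mult pderiv_pcompose pq smult_add_right ac_simps)
  also have "\<dots> = (\<Sum>j<Suc (length k). ?F j) + (\<Sum>j<Suc (length k). ?G j)"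
    by (simp only: sum.distrib lessThan_Suc_atMost)
  \<comment> \<open>The unpaired terms \<open>?F 0\<close> and \<open>?G (length k)\<close> vanish
    because their differentiated factor is \<open>L_star [] [] = 1\<close>.\<close>
  also have "\<dots> = (\<Sum>j<length k. ?F (Suc j) + ?G j)"
    unfolding sum.lessThan_Suc_shift[of ?F] sum.lessThan_Suc[of ?G]
    by (simp only: A_0 B_length sum.distrib) simp
  also have "\<dots> = 0"
    by (intro sum.neutral ballI cancel) simp
  finally have "degree (L_sym \<alpha> \<eta> k) = 0"
    by (simp only: pderiv_eq_0_iff)
  then show ?thesis
    by (blast elim: degree_eq_zeroE)
qed

end
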